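(* Let $\lambda$ be a rather odd partition, and let $q=q(\lambda)$, $\epsilon=\epsilon(\lambda)$, $\delta=\delta(\lambda)$ and $z=(0,1,2,\dots)$ (of the same length). Let $\Lambda\in\mathcal X^{2,0}_{d(\lambda)}$ be the symbol with linear presentation $(q+z-\delta,\epsilon)$. Then $\tilde\rho(\lambda)=\mathcal B(\Lambda)$, and $(q+z-\delta,\epsilon)$ is the canonical linear presentation of $\Lambda$.
   Context: A partition is rather odd if every even part occurs with even multiplicity and every odd part with multiplicity at most $1$; parts are written in non-decreasing order. $d(m)=0,1,-1$ according as $m$ is even, $m\equiv1$, $m\equiv3\pmod4$; $d(\lambda)=\sum_id(\lambda_i)$. For an integer $n$, $n=4q(n)+r(n)$ with $r(n)\in\{0,1,2,3\}$. **$\tilde\rho(\lambda)$** (a pair of partitions, zeros ignored). For $\lambda$ empty, $\tilde\rho(\lambda)=((0),(0))$. Otherwise, with $\lambda=(\lambda_1\le\dots\le\lambda_m)$, let $\mu$ be $\lambda$ with $\lambda_m$ removed if $\lambda_m$ is odd and with $\lambda_{m-1},\lambda_m$ removed if $\lambda_m$ is even; let $\tilde\rho(\mu)=(\gamma,\delta)$, $q=q(\lambda_m)$, $d=d(\mu)$. Then $\tilde\rho(\lambda)=(\alpha,\beta)$ with: $\alpha=(\gamma,q-d),\beta=(\delta,q+d)$ if $\lambda_m\equiv0$; $\alpha=(\gamma,q-d),\beta=\delta$ if $\lambda_m\equiv1$; $\alpha=(\gamma,q-d+1),\beta=(\delta,q+d)$ if $\lambda_m\equiv2$; $\alpha=\gamma,\beta=(\delta,q+d)$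 if $\lambda_m\equiv3\pmod 4$. **Sequences.** Write $\lambda=(\lambda_1^{a_1},\dots,\lambda_k^{a_k})$ with $\lambda_1<\dots<\lambda_k$, $a_i\geq 1$. $q(\lambda)=(q(\lambda_1)^{a_1},\dots,q(\lambda_k)^{a_k})$ (exponents denote repetition). $\epsilon(\lambda)$ is the concatenation of $\epsilon(r(\lambda_i),a_i)$, $i=1,\dots,k$, and $\delta(\lambda)$ that of $\delta(r(\lambda_i),a_i)$, where $\epsilon(r,a)$ is the sequence of length $a$: $(0,1,0,1,\dots)$ if $r=0$, $(0,0,\dots)$ if $r=1$, $(1,0,1,0,\dots)$ if $r=2$, $(1,1,\dots)$ if $r=3$; and $\delta(r,a)$ is the sequence of length $a$: $(0,1,0,1,\dots)$ if $r=0$, $(0,0,\dots)$ otherwise. **Symbols.** An element of $\mathcal X^{2,0}_d$ is represented by a pair $(X,Y)$ of finite sequences of nonnegative integers $X=(x_1,\dots,x_r)$, $Y=(y_1,\dots,y_s)$ with $x_j\ge x_{j-1}+2$, $y_j\ge y_{j-1}+2$ and $r-s=d$, modulo the equivalence generated by the shift $(X,Y)\sim(\{0\}\cup(X+2),\{0\}\cup(Y+2))$. $\mathcal B(X,Y)$ is the bipartition $(X-(0,2,4,\dots),\,Y-(0,2,4,\dots))$. A linear presentation of $(X,Y)$ is a pair $(Z,\epsilon)$, $Z$ a sequence of nonnegative integers and $\epsilon$ a sequence in $\{0,1\}$ of the same length $|X|+|Y|$, with $X=(Z_i\mid\epsilon_i=0)$ and $Y=(Z_i\mid\epsilon_i=1)$.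 It is canonical if $Z$ is non-decreasing and $\epsilon_i=0$ whenever $Z_i=Z_{i+1}$. *)

theory Defs
  imports Main
begin

text \<open>Partitions are non-decreasing lists of positive integers; the largest part is the last one.\<close>

definition is_partition :: "nat list \<Rightarrow> bool" where
  "is_partition lam \<longleftrightarrow> sorted lam \<and> (\<forall>p \<in> set lam. 0 < p)"

definition rather_odd :: "nat list \<Rightarrow> bool" where
  "rather_odd lam \<longleftrightarrow>
     is_partition lam \<and>
     (\<forall>p \<in> set lam. (even p \<longrightarrow> even (count_list lam p)) \<and> (odd p \<longrightarrow> count_list lam p \<le> 1))"

definition d_part :: "nat \<Rightarrow> int" where
  "d_part m = (if even m then 0 else if m mod 4 = 1 then 1 else - 1)"

definition d_partition :: "nat list \<Rightarrow> int" where
  "d_partition lam = sum_list (map d_part lam)"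

text \<open>
  Bipartitions are pairs of integer lists, so that the subtractions below never truncate.
  Two of them are identified if they agree after removal of all zeros; the function
  \<open>drop_zeros\<close> selects the representative without zeros.
\<close>

definition drop_zeros :: "int list \<times> int list \<Rightarrow> int list \<times> int list" where
  "drop_zeros = (\<lambda>(a, b). (filter (\<lambda>x. x \<noteq> 0) a, filter (\<lambda>x. x \<noteq> 0) b))"

function rho_raw :: "nat list \<Rightarrow> int list \<times> int list" where
  "rho_raw [] = ([0], [0])"
| "rho_raw (x # xs) =
    (let lam = x # xs;
         m = last lam;
         mu = (if odd m then butlast lam else butlast (butlast lam));
         (c, e) = rho_raw mu;
         q = int (m div 4);
         d = d_partition mu
     in if m mod 4 = 0 then (c @ [q - d], e @ [q + d])
        else if m mod 4 = 1 then (c @ [q - d], e)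
        else if m mod 4 = 2 then (c @ [q - d + 1], e @ [q + d])
        else (c, e @ [q + d]))"
  by pat_completeness auto
termination
  by (relation "measure length") auto

definition rho_tilde :: "nat list \<Rightarrow> int list \<times> int list" where
  "rho_tilde lam = drop_zeros (rho_raw lam)"

text \<open>
  With \<open>distinct_parts lam = [p\<^sub>1, \<dots>, p\<^sub>k]\<close> (increasing) and \<open>a\<^sub>i = count_list lam p\<^sub>i\<close>, each
  sequence is a concatenation of blocks of lengths \<open>a\<^sub>1, \<dots>, a\<^sub>k\<close>.
\<close>

definition distinct_parts :: "nat list \<Rightarrow> nat list" where
  "distinct_parts lam = sorted_list_of_set (set lam)"

definition eps_block :: "nat \<Rightarrow> nat \<Rightarrow> nat list" where
  "eps_block r a =
     map (\<lambda>i. if r = 0 then i mod 2 else if r = 1 then 0 else if r = 2 then (i + 1) mod 2 else 1)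
       [0..<a]"

definition delta_block :: "nat \<Rightarrow> nat \<Rightarrow> nat list" where
  "delta_block r a = map (\<lambda>i. if r = 0 then i mod 2 else 0) [0..<a]"

definition q_seq :: "nat list \<Rightarrow> nat list" where
  "q_seq lam = concat (map (\<lambda>p. replicate (count_list lam p) (p div 4)) (distinct_parts lam))"

definition eps_seq :: "nat list \<Rightarrow> nat list" where
  "eps_seq lam = concat (map (\<lambda>p. eps_block (p mod 4) (count_list lam p)) (distinct_parts lam))"

definition delta_seq :: "nat list \<Rightarrow> nat list" where
  "delta_seq lam = concat (map (\<lambda>p. delta_block (p mod 4) (count_list lam p)) (distinct_parts lam))"

type_synonym symbol_pair = "int list \<times> int list"

definition symbol_row :: "int list \<Rightarrow> bool" where
  "symbol_row X \<longleftrightarrow> (\<forall>x \<in> set X. 0 \<le> x) \<and> successively (\<lambda>x y. x + 2 \<le> y) X"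

definition symbol_pairs :: "int \<Rightarrow> symbol_pair set" where
  "symbol_pairs d =
     {(X, Y). symbol_row X \<and> symbol_row Y \<and> int (length X) - int (length Y) = d}"

definition shift :: "symbol_pair \<Rightarrow> symbol_pair" where
  "shift = (\<lambda>(X, Y). (0 # map (\<lambda>x. x + 2) X, 0 # map (\<lambda>y. y + 2) Y))"

definition shift_equiv :: "int \<Rightarrow> (symbol_pair \<times> symbol_pair) set" where
  "shift_equiv d =
     {(P, Q). P \<in> symbol_pairs d \<and> Q \<in> symbol_pairs d \<and> equivclp (\<lambda>P Q. Q = shift P) P Q}"

definition symbols :: "int \<Rightarrow> symbol_pair set set" where
  "symbols d = symbol_pairs d // shift_equiv d"

text \<open>
  A shift only adds a zero at the front of both entries of the bipartition, so after removal of
  zeros the bipartition is constant on the classes in \<open>symbols d\<close>.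
\<close>

definition row_partition :: "int list \<Rightarrow> int list" where
  "row_partition X = map (\<lambda>i. X ! i - 2 * int i) [0..<length X]"

definition pair_bipartition :: "symbol_pair \<Rightarrow> int list \<times> int list" where
  "pair_bipartition = (\<lambda>(X, Y). drop_zeros (row_partition X, row_partition Y))"

definition symbol_bipartition :: "symbol_pair set \<Rightarrow> int list \<times> int list" where
  "symbol_bipartition L = the_elem (pair_bipartition ` L)"

definition linear_presentation :: "symbol_pair \<Rightarrow> int list \<Rightarrow> nat list \<Rightarrow> bool" where
  "linear_presentation = (\<lambda>(X, Y) Z e.
     length Z = length X + length Y \<and> length e = length X + length Y \<and>
     (\<forall>z \<in> set Z. 0 \<le> z) \<and> set e \<subseteq> {0, 1} \<and>
     X = map fst (filter (\<lambda>(z, s). s = 0) (zip Z e)) \<and>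
     Y = map fst (filter (\<lambda>(z, s). s = 1) (zip Z e)))"

definition canonical_linear_presentation :: "symbol_pair \<Rightarrow> int list \<Rightarrow> nat list \<Rightarrow> bool" where
  "canonical_linear_presentation P Z e \<longleftrightarrow>
     linear_presentation P Z e \<and> sorted Z \<and>
     (\<forall>i. Suc i < length Z \<longrightarrow> Z ! i = Z ! Suc i \<longrightarrow> e ! i = 0)"

end

theory Submission imports Defs begin

text \<open>
  A non-empty rather odd partition is obtained from a smaller one, \<open>\<mu>\<close>, by putting on top of it
  either one odd part \<open>m\<close> larger than all others, or two copies of an even part \<open>m\<close> at least as
  large as all others.  These are exactly the parts that the recursion for \<open>\<rho>\<close> removes, so
  everything goes by induction along this construction (\<open>rather_odd_induct\<close>).

  Write \<open>n\<close> for the number of parts of \<open>\<mu>\<close>.  Since even parts come in pairs, the blocks of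
  \<open>\<epsilon>\<close> and \<open>\<delta>\<close> have even length there, and passing from \<open>\<mu>\<close> to the
  larger partition only appends to the linear presentation the one or two entries called
  \<open>new_entries m n\<close> (\<open>entries_append\<close>), at most one to each row.  An entry of value \<open>q + n\<close> that
  lands in the row \<open>X\<close> contributes to the bipartition \<open>q + n - 2|X| = q - (|X| - |Y|) = q - d(\<mu>)\<close>,
  because \<open>n = |X| + |Y|\<close>; one that lands in \<open>Y\<close> contributes \<open>q + d(\<mu>)\<close>.  The only entry of
  another value is \<open>q + n + 1\<close> in \<open>X\<close> for \<open>m \<equiv> 2\<close>, which explains the extra 1 in the recursion
  there; for \<open>m \<equiv> 0\<close> the term \<open>\<delta>\<close> cancels it.  So the contributions are the parts that
  \<open>\<rho>\<close> appends (\<open>rho_raw_eq_row_partitions\<close>).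

  The inequalities that make the rows into a symbol, and the order of the linear presentation,
  follow from upper bounds on the entries in terms of \<open>n\<close> and of a bound for the parts
  (\<open>entries_bounds\<close>).  Finally, if both rows have distinct entries, a linear presentation is canonical
  precisely when the numbers \<open>2 Z\<^sub>i + \<epsilon>\<^sub>i\<close> increase strictly
  (\<open>canonical_iff_keys_increasing\<close>).  As the set of these numbers is determined by the two rows,
  the canonical presentation is unique.
\<close>

section \<open>Building rather odd partitions from the bottom\<close>

definition top_parts :: "nat \<Rightarrow> nat list" where
  "top_parts m = (if odd m then [m] else [m, m])"

text \<open>
  The bound \<open>m - m mod 2\<close> covers both parities: an odd new part has to exceed the old ones, an even
  one may repeat the largest of them.
\<close>

lemma rather_odd_induct [consumes 1, case_names empty step]:
  assumes "rather_odd lam"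
    and "P []"
    and step: "\<And>mu m. rather_odd mu \<Longrightarrow> 0 < m \<Longrightarrow> \<forall>p \<in> set mu. p \<le> m - m mod 2 \<Longrightarrow> P mu
                 \<Longrightarrow> P (mu @ top_parts m)"
  shows "P lam"
  using assms(1)
proof (induction lam rule: length_induct)
  case (1 lam)
  show ?case
  proof (cases "lam = []")
    case True
    with assms(2) show ?thesis by simp
  next
    case False
    define m where "m = last lam"
    define nu where "nu = butlast lam"
    have lam: "lam = nu @ [m]" using False by (simp add: m_def nu_def)
    have sorted: "sorted nu" "\<forall>p \<in> set nu. p \<le> m" and pos: "0 < m" "\<forall>p \<in> set nu. 0 < p"
      using 1(2) by (auto simp: rather_odd_def is_partition_def lam sorted_append)
    have ev: "even p \<Longrightarrow> p \<in> set lam \<Longrightarrow> even (count_list lam p)"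
      and od: "odd p \<Longrightarrow> p \<in> set lam \<Longrightarrow> count_list lam p \<le> 1" for p
      using 1(2) by (auto simp: rather_odd_def)
    show ?thesis
    proof (cases "odd m")
      case True
      have "count_list nu m = 0" using od[OF True] by (simp add: lam)
      hence notin: "m \<notin> set nu" by (simp add: count_list_0_iff)
      have "even p \<Longrightarrow> p \<in> set nu \<Longrightarrow> even (count_list nu p)"
        and "odd p \<Longrightarrow> p \<in> set nu \<Longrightarrow> count_list nu p \<le> 1" for p
        using ev[of p] od[of p] notin by (auto simp: lam split: if_splits)
      hence nu: "rather_odd nu" using sorted pos by (auto simp: rather_odd_def is_partition_def)
      have "p < m" if "p \<in> set nu" for p
        using that sorted(2) notin by (metis le_neq_implies_less)
      hence "\<forall>p \<in> set nu. p \<le> m - m mod 2" using True by (fastforce simp: odd_iff_mod_2_eq_one)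
      moreover have "P nu" using 1(1) nu by (simp add: lam)
      ultimately have "P (nu @ top_parts m)" using nu pos by (intro step) auto
      with True show ?thesis by (simp add: lam top_parts_def)
    next
      case False
      have "odd (count_list nu m)" using ev[of m] False by (simp add: lam)
      hence m_in: "m \<in> set nu" by (metis count_notin even_zero)
      define mu where "mu = butlast nu"
      have ne: "nu \<noteq> []" using m_in by auto
      have nu_snoc: "nu = mu @ [last nu]" using ne by (simp add: mu_def)
      have last_ge: "m \<le> last nu"
        using m_in sorted(1) nu_snoc by (metis sorted_append set_append Un_iff list.set_intros(1)
            empty_iff empty_set order_refl set_ConsD)
      have "last nu = m" using last_ge sorted(2) ne by (simp add: order_antisym)
      hence nu: "nu = mu @ [m]" using nu_snoc by simp
      have "even p \<Longrightarrow> p \<in> set mu \<Longrightarrow> even (count_list mu p)"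
        and "odd p \<Longrightarrow> p \<in> set mu \<Longrightarrow> count_list mu p \<le> 1" for p
        using ev[of p] od[of p] by (auto simp: lam nu split: if_splits)
      hence mu: "rather_odd mu"
        using sorted pos by (auto simp: rather_odd_def is_partition_def nu sorted_append)
      have "\<forall>p \<in> set mu. p \<le> m - m mod 2" using sorted False by (auto simp: nu)
      moreover have "P mu" using 1(1) mu by (simp add: lam nu)
      ultimately have "P (mu @ top_parts m)" using mu pos by (intro step) auto
      with False show ?thesis by (simp add: lam nu top_parts_def)
    qed
  qed
qed

lemma count_list_top_part:
  assumes "rather_odd mu" and "0 < m" and "\<forall>p \<in> set mu. p \<le> m - m mod 2"
  shows "even m \<Longrightarrow> even (count_list mu m)" and "odd m \<Longrightarrow> count_list mu m = 0"
proof -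
  show "even m \<Longrightarrow> even (count_list mu m)"
    using assms(1) by (cases "m \<in> set mu") (auto simp: rather_odd_def)
  assume "odd m"
  hence "m - m mod 2 < m" by (simp add: odd_iff_mod_2_eq_one odd_pos)
  hence "m \<notin> set mu" using assms(3) by (auto simp: not_le[symmetric])
  thus "count_list mu m = 0" by simp
qed

section \<open>The linear presentation grows at the end\<close>

text \<open>
  The condition \<open>f m 0 = []\<close> makes the case where \<open>m\<close> is a new part an instance of the case where
  it already occurs.
\<close>

lemma concat_blocks_append:
  fixes f :: "nat \<Rightarrow> nat \<Rightarrow> 'a list"
  assumes le: "\<forall>p \<in> set mu. p \<le> m" and f0: "f m 0 = []" and t: "set t = {m}"
    and f: "f m (count_list mu m + length t) = f m (count_list mu m) @ u"
  shows "concat (map (\<lambda>p. f p (count_list (mu @ t) p)) (distinct_parts (mu @ t))) =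
         concat (map (\<lambda>p. f p (count_list mu p)) (distinct_parts mu)) @ u"
proof -
  define ps where "ps = sorted_list_of_set (set mu - {m})"
  have set_ps: "set ps = set mu - {m}" by (simp add: ps_def)
  have "sorted (ps @ [m])" "distinct (ps @ [m])"
    using le by (auto simp: ps_def sorted_append)
  hence top: "sorted_list_of_set (set (ps @ [m])) = ps @ [m]"
    by (simp only: sorted_list_of_set.idem_if_sorted_distinct)
  have "set (mu @ t) = set (ps @ [m])" using t set_ps by auto
  hence new: "distinct_parts (mu @ t) = ps @ [m]" using top by (simp only: distinct_parts_def)
  have old: "concat (map (\<lambda>p. f p (count_list mu p)) (distinct_parts mu)) =
             concat (map (\<lambda>p. f p (count_list mu p)) ps) @ f m (count_list mu m)"
  proof (cases "m \<in> set mu")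
    case True
    hence "set mu = set (ps @ [m])" using set_ps by auto
    hence "distinct_parts mu = ps @ [m]" using top by (simp only: distinct_parts_def)
    thus ?thesis by simp
  next
    case False
    thus ?thesis using f0 by (simp add: distinct_parts_def ps_def)
  qed
  have "count_list t p = 0" if "p \<noteq> m" for p using that t by (intro count_notin) auto
  hence same: "map (\<lambda>p. f p (count_list (mu @ t) p)) ps = map (\<lambda>p. f p (count_list mu p)) ps"
    using set_ps by (intro map_cong) auto
  have "count_list xs m = length xs" if "set xs \<subseteq> {m}" for xs using that by (induction xs) auto
  hence "count_list (mu @ t) m = count_list mu m + length t" using t by simp
  thus ?thesis unfolding new old map_append concat_append same using f by simp
qed

lemma set_top_parts: "set (top_parts m) = {m}"
  by (simp add: top_parts_def)

text \<open>
  The blocks for even \<open>m\<close> alternate with period 2, and \<open>m\<close> already occurs an even number of times,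
  so two more copies of \<open>m\<close> extend them by a fresh block of length 2.
\<close>

lemma
  assumes mu: "rather_odd mu" and m: "0 < m" and le: "\<forall>p \<in> set mu. p \<le> m - m mod 2"
  shows q_seq_append: "q_seq (mu @ top_parts m) = q_seq mu @ map (\<lambda>p. p div 4) (top_parts m)"
    and eps_seq_append: "eps_seq (mu @ top_parts m) =
          eps_seq mu @ eps_block (m mod 4) (length (top_parts m))"
    and delta_seq_append: "delta_seq (mu @ top_parts m) =
          delta_seq mu @ delta_block (m mod 4) (length (top_parts m))"
proof -
  have le': "\<forall>p \<in> set mu. p \<le> m" using le diff_le_self order_trans by blast
  note counts = count_list_top_part[OF mu m le]
  show "q_seq (mu @ top_parts m) = q_seq mu @ map (\<lambda>p. p div 4) (top_parts m)"
    unfolding q_seq_def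
    by (rule concat_blocks_append[OF le' _ set_top_parts])
      (auto simp: top_parts_def replicate_append_same replicate_app_Cons_same)
  show "eps_seq (mu @ top_parts m) = eps_seq mu @ eps_block (m mod 4) (length (top_parts m))"
    unfolding eps_seq_def
    by (rule concat_blocks_append[OF le' _ set_top_parts])
      (use counts in \<open>auto simp: top_parts_def eps_block_def mod_2_eq_odd\<close>)
  show "delta_seq (mu @ top_parts m) = delta_seq mu @ delta_block (m mod 4) (length (top_parts m))"
    unfolding delta_seq_def
    by (rule concat_blocks_append[OF le' _ set_top_parts])
      (use counts in \<open>auto simp: top_parts_def delta_block_def mod_2_eq_odd\<close>)
qed

lemma length_seqs:
  assumes "rather_odd lam"
  shows "length (q_seq lam) = length lam" and "length (eps_seq lam) = length lam"
    and "length (delta_seq lam) = length lam"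
proof -
  have "length (q_seq lam) = length lam \<and> length (eps_seq lam) = length lam \<and>
        length (delta_seq lam) = length lam"
    using assms
  proof (induction rule: rather_odd_induct)
    case empty
    show ?case by (simp add: q_seq_def eps_seq_def delta_seq_def distinct_parts_def)
  next
    case (step mu m)
    thus ?case
      by (simp add: q_seq_append eps_seq_append delta_seq_append eps_block_def delta_block_def)
  qed
  thus "length (q_seq lam) = length lam" "length (eps_seq lam) = length lam"
    "length (delta_seq lam) = length lam" by auto
qed

definition shifted_quotients :: "nat list \<Rightarrow> int list" where
  "shifted_quotients lam =
     map (\<lambda>i. int (q_seq lam ! i) + int i - int (delta_seq lam ! i)) [0..<length (q_seq lam)]"

definition entries :: "nat list \<Rightarrow> (int \<times> nat) list" where
  "entries lam = zip (shifted_quotients lam) (eps_seq lam)"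

definition new_entries :: "nat \<Rightarrow> nat \<Rightarrow> (int \<times> nat) list" where
  "new_entries m n =
     (if m mod 4 = 0 then [(int (m div 4 + n), 0), (int (m div 4 + n), 1)]
      else if m mod 4 = 1 then [(int (m div 4 + n), 0)]
      else if m mod 4 = 2 then [(int (m div 4 + n), 1), (int (m div 4 + n) + 1, 0)]
      else [(int (m div 4 + n), 1)])"

lemma residue_cases:
  fixes m :: nat
  obtains "m mod 4 = 0" "even m" | "m mod 4 = 1" "odd m" | "m mod 4 = 2" "even m"
    | "m mod 4 = 3" "odd m"
proof -
  have "m mod 4 = 0 \<and> even m \<or> m mod 4 = 1 \<and> odd m \<or> m mod 4 = 2 \<and> even m \<or> m mod 4 = 3 \<and> odd m"
    by presburger
  thus ?thesis by (elim disjE conjE) (rule that; assumption)+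
qed

lemma entries_empty: "entries [] = []"
  by (simp add: entries_def shifted_quotients_def q_seq_def distinct_parts_def)

lemma entries_append:
  assumes mu: "rather_odd mu" and m: "0 < m" and le: "\<forall>p \<in> set mu. p \<le> m - m mod 2"
  shows "entries (mu @ top_parts m) = entries mu @ new_entries m (length mu)"
proof -
  note len = length_seqs[OF mu]
  have idx: "[0..<length mu + k] = [0..<length mu] @ map (\<lambda>i. length mu + i) [0..<k]" for k
    using upt_add_eq_append[of 0 "length mu" k] map_add_upt[of "length mu" k]
    by (simp add: add.commute)
  have vals: "shifted_quotients (mu @ top_parts m) = shifted_quotients mu @
      map (\<lambda>i. int (map (\<lambda>p. p div 4) (top_parts m) ! i) + int (length mu + i)
               - int (delta_block (m mod 4) (length (top_parts m)) ! i)) [0..<length (top_parts m)]"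
    by (auto simp: shifted_quotients_def q_seq_append[OF assms] delta_seq_append[OF assms] len idx
        nth_append)
  have "length (shifted_quotients mu) = length (eps_seq mu)"
    by (simp add: shifted_quotients_def len)
  thus ?thesis
    unfolding entries_def eps_seq_append[OF assms] vals
    by (cases m rule: residue_cases)
      (auto simp: new_entries_def eps_block_def delta_block_def top_parts_def)
qed

section \<open>The bipartition\<close>

definition row :: "nat \<Rightarrow> (int \<times> nat) list \<Rightarrow> int list" where
  "row s ps = map fst (filter (\<lambda>(z, t). t = s) ps)"

lemma row_append: "row s (ps @ ps') = row s ps @ row s ps'"
  by (simp add: row_def)

lemma row_simps [simp]:
  "row s [] = []" "row s ((z, t) # ps) = (if t = s then z # row s ps else row s ps)"
  by (simp_all add: row_def)

lemma row_partition_snoc: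
  "row_partition (X @ [x]) = row_partition X @ [x - 2 * int (length X)]"
  by (auto simp: row_partition_def nth_append)

lemma length_rows:
  assumes "rather_odd lam"
  shows "int (length (row 0 (entries lam))) + int (length (row 1 (entries lam))) = int (length lam)"
    and "int (length (row 0 (entries lam))) - int (length (row 1 (entries lam))) = d_partition lam"
proof -
  have "int (length (row 0 (entries lam))) + int (length (row 1 (entries lam))) = int (length lam) \<and>
        int (length (row 0 (entries lam))) - int (length (row 1 (entries lam))) = d_partition lam"
    using assms
  proof (induction rule: rather_odd_induct)
    case empty
    show ?case by (simp add: entries_empty d_partition_def)
  next
    case (step mu m)
    have "d_partition (mu @ top_parts m) = d_partition mu + d_part m"
      by (simp add: d_partition_def top_parts_def d_part_def)
    thus ?case
      unfolding entries_append[OF step(1-3)] using step(4)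
      by (cases m rule: residue_cases)
        (simp_all add: row_append new_entries_def top_parts_def d_part_def)
  qed
  thus "int (length (row 0 (entries lam))) + int (length (row 1 (entries lam))) = int (length lam)"
    and "int (length (row 0 (entries lam))) - int (length (row 1 (entries lam))) = d_partition lam"
    by auto
qed

lemma rho_raw_append:
  "rho_raw (mu @ top_parts m) =
    (let (c, e) = rho_raw mu; q = int (m div 4); d = d_partition mu
     in if m mod 4 = 0 then (c @ [q - d], e @ [q + d])
        else if m mod 4 = 1 then (c @ [q - d], e)
        else if m mod 4 = 2 then (c @ [q - d + 1], e @ [q + d])
        else (c, e @ [q + d]))"
proof -
  obtain x xs where lam: "mu @ top_parts m = x # xs"
    by (cases "mu @ top_parts m") (auto simp: top_parts_def split: if_splits)
  have last: "last (x # xs) = m" unfolding lam[symmetric] by (simp add: top_parts_def)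
  have rest: "(if odd m then butlast (x # xs) else butlast (butlast (x # xs))) = mu"
    unfolding lam[symmetric] by (simp add: top_parts_def butlast_append)
  show ?thesis
    unfolding lam rho_raw.simps Let_def last rest by (rule refl)
qed

text \<open>The leading zeros come from the value \<open>((0), (0))\<close> at the empty partition.\<close>

lemma rho_raw_eq_row_partitions:
  assumes "rather_odd lam"
  shows "rho_raw lam =
    (0 # row_partition (row 0 (entries lam)), 0 # row_partition (row 1 (entries lam)))"
  using assms
proof (induction rule: rather_odd_induct)
  case empty
  show ?case by (simp add: entries_empty row_partition_def)
next
  case (step mu m)
  note len = length_rows[OF step(1)]
  show ?case
    using len step(4)
    by (cases m rule: residue_cases)
      (auto simp: rho_raw_append entries_append[OF step(1-3)] row_append row_partition_snoc
        new_entries_def Let_def)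
qed

section \<open>Gaps in the rows and order of the entries\<close>

text \<open>
  The first two bounds are chosen to leave a gap of at least 2 to what is appended next: a part \<open>m\<close>
  on top of parts bounded by \<open>M = m - m mod 2\<close> adds to row 0 the value \<open>n + (m + 2) div 4 = n + (M + 3) div 4\<close>
  (if \<open>m mod 4 \<noteq> 3\<close>), to row 1 the value \<open>n + m div 4 = n + (M + 1) div 4\<close> (if \<open>m mod 4 \<noteq> 1\<close>).
  It adds no value below \<open>n + m div 4 = n + M div 4\<close> to either row, so the third bound puts all new
  entries strictly above the old ones.
\<close>

lemma entries_bounds:
  assumes "rather_odd lam" and "\<forall>p \<in> set lam. p \<le> M"
  shows "\<forall>x \<in> set (row 0 (entries lam)). x + 2 \<le> int (length lam) + int ((M + 3) div 4)"
    and "\<forall>y \<in> set (row 1 (entries lam)). y + 2 \<le> int (length lam) + int ((M + 1) div 4)"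
    and "\<forall>(z, s) \<in> set (entries lam). z < int (length lam) + int (M div 4)"
proof -
  have "(\<forall>x \<in> set (row 0 (entries lam)). x + 2 \<le> int (length lam) + int ((M + 3) div 4)) \<and>
        (\<forall>y \<in> set (row 1 (entries lam)). y + 2 \<le> int (length lam) + int ((M + 1) div 4)) \<and>
        (\<forall>(z, s) \<in> set (entries lam). z < int (length lam) + int (M div 4))"
    using assms
  proof (induction arbitrary: M rule: rather_odd_induct)
    case empty
    show ?case by (simp add: entries_empty)
  next
    case (step mu m)
    have mM: "m \<le> M" and muM: "\<forall>p \<in> set mu. p \<le> M"
      using step(5) by (auto simp: set_top_parts)
    note append = entries_append[OF step(1-3)]
    have old: "\<forall>x \<in> set (row 0 (entries mu)).
          x + 2 \<le> int (length (mu @ top_parts m)) + int ((M + 3) div 4)"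
        "\<forall>y \<in> set (row 1 (entries mu)).
          y + 2 \<le> int (length (mu @ top_parts m)) + int ((M + 1) div 4)"
        "\<forall>(z, s) \<in> set (entries mu). z < int (length (mu @ top_parts m)) + int (M div 4)"
      using step(4)[OF muM] by fastforce+
    show ?case
    proof (cases m rule: residue_cases)
      case 1
      have "m div 4 \<le> M div 4" using mM by (rule div_le_mono)
      moreover have "M div 4 \<le> (M + 1) div 4" "M div 4 \<le> (M + 3) div 4" by (rule div_le_mono, simp)+
      ultimately show ?thesis
        unfolding append row_append set_append ball_Un using old 1
        by (simp add: new_entries_def top_parts_def)
    next
      case 2
      have "(m + 3) div 4 \<le> (M + 3) div 4" "m div 4 \<le> M div 4" using mM by (simp_all add: div_le_mono)
      moreover have "(m + 3) div 4 = m div 4 + 1" using 2 by presburger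
      ultimately show ?thesis
        unfolding append row_append set_append ball_Un using old 2
        by (simp add: new_entries_def top_parts_def)
    next
      case 3
      have "(m + 3) div 4 \<le> (M + 3) div 4" "m div 4 \<le> M div 4" using mM by (simp_all add: div_le_mono)
      moreover have "(m + 3) div 4 = m div 4 + 1" using 3 by presburger
      moreover have "M div 4 \<le> (M + 1) div 4" by (rule div_le_mono) simp
      ultimately show ?thesis
        unfolding append row_append set_append ball_Un using old 3
        by (simp add: new_entries_def top_parts_def)
    next
      case 4
      have "(m + 1) div 4 \<le> (M + 1) div 4" "m div 4 \<le> M div 4" using mM by (simp_all add: div_le_mono)
      moreover have "(m + 1) div 4 = m div 4 + 1" using 4 by presburger
      ultimately show ?thesis
        unfolding append row_append set_append ball_Un using old 4
        by (simp add: new_entries_def top_parts_def)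
    qed
  qed
  thus "\<forall>x \<in> set (row 0 (entries lam)). x + 2 \<le> int (length lam) + int ((M + 3) div 4)"
    and "\<forall>y \<in> set (row 1 (entries lam)). y + 2 \<le> int (length lam) + int ((M + 1) div 4)"
    and "\<forall>(z, s) \<in> set (entries lam). z < int (length lam) + int (M div 4)"
    by auto
qed

lemma symbol_row_snoc:
  assumes "symbol_row X" and "0 \<le> x" and "\<forall>y \<in> set X. y + 2 \<le> x"
  shows "symbol_row (X @ [x])"
  using assms by (cases "X = []") (auto simp: symbol_row_def successively_append_iff)

lemma div_4_rounded:
  fixes m :: nat
  shows "(m - m mod 2) div 4 = m div 4" and "(m - m mod 2 + 1) div 4 = m div 4"
    and "(m - m mod 2 + 3) div 4 = (m + 2) div 4"
  unfolding minus_mod_eq_mult_div by presburger+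

lemma symbol_row_entries:
  assumes "rather_odd lam"
  shows "symbol_row (row 0 (entries lam))" and "symbol_row (row 1 (entries lam))"
proof -
  have "symbol_row (row 0 (entries lam)) \<and> symbol_row (row 1 (entries lam))"
    using assms
  proof (induction rule: rather_odd_induct)
    case empty
    show ?case by (simp add: entries_empty symbol_row_def)
  next
    case (step mu m)
    note bounds = entries_bounds(1,2)[OF step(1,3), unfolded div_4_rounded]
    show ?case
    proof (cases m rule: residue_cases)
      case 1
      have "(m + 2) div 4 = m div 4" using 1 by presburger
      thus ?thesis using step(4) bounds 1
        by (auto simp: entries_append[OF step(1-3)] row_append new_entries_def add.commute
            intro!: symbol_row_snoc)
    next
      case 2
      have "(m + 2) div 4 = m div 4" using 2 by presburger
      thus ?thesis using step(4) bounds 2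
        by (auto simp: entries_append[OF step(1-3)] row_append new_entries_def add.commute
            intro!: symbol_row_snoc)
    next
      case 3
      have "(m + 2) div 4 = m div 4 + 1" using 3 by presburger
      thus ?thesis using step(4) bounds 3
        by (auto simp: entries_append[OF step(1-3)] row_append new_entries_def algebra_simps
            intro!: symbol_row_snoc)
    next
      case 4
      show ?thesis using step(4) bounds 4
        by (auto simp: entries_append[OF step(1-3)] row_append new_entries_def add.commute
            intro!: symbol_row_snoc)
    qed
  qed
  thus "symbol_row (row 0 (entries lam))" and "symbol_row (row 1 (entries lam))" by auto
qed

text \<open>On entries with second component 0 or 1 this encodes the lexicographic order.\<close>

definition key :: "int \<times> nat \<Rightarrow> int" where
  "key = (\<lambda>(z, s). 2 * z + int s)"

lemma entries_range:
  assumes "rather_odd lam"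
  shows "\<forall>(z, s) \<in> set (entries lam). 0 \<le> z \<and> s \<in> {0, 1}"
  using assms
proof (induction rule: rather_odd_induct)
  case empty
  show ?case by (simp add: entries_empty)
next
  case (step mu m)
  thus ?case
    by (cases m rule: residue_cases) (auto simp: entries_append[OF step(1-3)] new_entries_def)
qed

lemma entries_keys_increasing:
  assumes "rather_odd lam"
  shows "sorted_wrt (<) (map key (entries lam))"
  using assms
proof (induction rule: rather_odd_induct)
  case empty
  show ?case by (simp add: entries_empty)
next
  case (step mu m)
  have "key e < 2 * (int (m div 4) + int (length mu))" if "e \<in> set (entries mu)" for e
    using entries_bounds(3)[OF step(1,3), unfolded div_4_rounded] entries_range[OF step(1)] that
    by (fastforce simp: key_def)
  moreover have "2 * (int (m div 4) + int (length mu)) \<le> key e"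
    if "e \<in> set (new_entries m (length mu))" for e
    using that by (cases m rule: residue_cases) (auto simp: new_entries_def key_def)
  ultimately have "key e < key e'"
    if "e \<in> set (entries mu)" "e' \<in> set (new_entries m (length mu))" for e e'
    using that by (meson less_le_trans)
  moreover have "sorted_wrt (<) (map key (new_entries m (length mu)))"
    by (cases m rule: residue_cases) (auto simp: new_entries_def key_def)
  ultimately show ?case
    using step(4) by (auto simp: entries_append[OF step(1-3)] sorted_wrt_append)
qed

section \<open>Canonical linear presentations\<close>

text \<open>
  When all \<open>\<epsilon>\<^sub>i\<close> are 0 or 1, every entry lands in exactly one row, which turns the two conditions on
  \<open>|X| + |Y|\<close> into \<open>length Z = length e\<close>.
\<close>

lemma linear_presentation_iff:
  "linear_presentation (X, Y) Z e \<longleftrightarrow>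
     length Z = length e \<and> (\<forall>z \<in> set Z. 0 \<le> z) \<and> set e \<subseteq> {0, 1} \<and>
     X = row 0 (zip Z e) \<and> Y = row 1 (zip Z e)"
proof (cases "set e \<subseteq> {0, 1} \<and> X = row 0 (zip Z e) \<and> Y = row 1 (zip Z e)")
  case True
  have rows: "length (row 0 ps) + length (row 1 ps) = length ps"
    if "\<forall>(z, t) \<in> set ps. t \<in> {0, 1}" for ps
    using that by (induction ps) auto
  have "\<forall>(z, t) \<in> set (zip Z e). t \<in> {0, 1}" using True by (auto dest: set_zip_rightD)
  hence "length X + length Y = min (length Z) (length e)" using rows True by simp
  hence "length Z = length X + length Y \<and> length e = length X + length Y \<longleftrightarrow> length Z = length e"
    by linarith
  thus ?thesis using True by (simp add: linear_presentation_def row_def[symmetric]) blast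
next
  case False
  thus ?thesis by (auto simp: linear_presentation_def row_def[symmetric])
qed

lemma set_row: "set (row s ps) = {z. (z, s) \<in> set ps}"
  by (force simp: row_def)

lemma distinct_if_rows_distinct:
  assumes "snd ` set ps \<subseteq> {0, 1}" and "distinct (row 0 ps)" and "distinct (row 1 ps)"
  shows "distinct ps"
  using assms by (induction ps) (auto simp: set_row split: if_splits)

text \<open>
  On a tie \<open>Z\<^sub>i = Z\<^sub>i\<^sub>+\<^sub>1\<close> the canonical condition gives \<open>\<epsilon>\<^sub>i = 0\<close>, and distinctness of the
  row then forces \<open>\<epsilon>\<^sub>i\<^sub>+\<^sub>1 = 1\<close>.
\<close>

lemma canonical_iff_keys_increasing:
  assumes lp: "linear_presentation (X, Y) Z e" and "distinct X" and "distinct Y"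
  shows "canonical_linear_presentation (X, Y) Z e \<longleftrightarrow> sorted_wrt (<) (map key (zip Z e))"
proof -
  have len: "length Z = length e" and e: "set e \<subseteq> {0, 1}"
    and rows: "X = row 0 (zip Z e)" "Y = row 1 (zip Z e)"
    using lp by (auto simp: linear_presentation_iff)
  have e01: "e ! i = 0 \<or> e ! i = 1" if "i < length Z" for i
    using that e len by (metis insertE nth_mem singletonD subsetD)
  have "snd ` set (zip Z e) \<subseteq> {0, 1}" using e by (auto dest: set_zip_rightD)
  hence dist: "distinct (zip Z e)" using assms(2,3) rows by (intro distinct_if_rows_distinct) auto
  have adj: "Z ! i < Z ! Suc i \<or> Z ! i = Z ! Suc i \<and> e ! i = 0 \<longleftrightarrow>
             key (Z ! i, e ! i) < key (Z ! Suc i, e ! Suc i)" if i: "Suc i < length Z" for i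
  proof -
    have "zip Z e ! i \<noteq> zip Z e ! Suc i" 
      using nth_eq_iff_index_eq[OF dist, of i "Suc i"] i len by simp
    hence "Z ! i \<noteq> Z ! Suc i \<or> e ! i \<noteq> e ! Suc i" using i len by simp
    thus ?thesis using e01[of i] e01[of "Suc i"] i by (auto simp: key_def)
  qed
  have "canonical_linear_presentation (X, Y) Z e \<longleftrightarrow>
        (\<forall>i. Suc i < length Z \<longrightarrow> Z ! i < Z ! Suc i \<or> Z ! i = Z ! Suc i \<and> e ! i = 0)"
  proof -
    have "a < b \<or> a = b \<and> c \<longleftrightarrow> a \<le> b \<and> (a = b \<longrightarrow> c)" for a b :: int and c by auto
    thus ?thesis using lp unfolding canonical_linear_presentation_def sorted_iff_nth_Suc by blast
  qed
  also have "\<dots> \<longleftrightarrow> (\<forall>i. Suc i < length Z \<longrightarrow> key (Z ! i, e ! i) < key (Z ! Suc i, e ! Suc i))"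
    using adj by blast
  also have "\<dots> \<longleftrightarrow> sorted_wrt (<) (map key (zip Z e))"
    using len by (simp add: sorted_wrt_iff_nth_Suc_transp)
  finally show ?thesis .
qed

lemma canonical_linear_presentation_unique:
  assumes "distinct X" and "distinct Y"
    and "canonical_linear_presentation (X, Y) Z e" and "canonical_linear_presentation (X, Y) Z' e'"
  shows "Z' = Z \<and> e' = e"
proof -
  have lp: "linear_presentation (X, Y) Z e" "linear_presentation (X, Y) Z' e'"
    using assms(3,4) by (auto simp: canonical_linear_presentation_def)
  have sorted: "sorted_wrt (<) (map key (zip Z e))" "sorted_wrt (<) (map key (zip Z' e'))"
    using canonical_iff_keys_increasing[OF _ assms(1,2)] lp assms(3,4) by auto
  have entries: "set (zip A f) = set X \<times> {0} \<union> set Y \<times> {1}"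
    and len: "length A = length f"
    if "linear_presentation (X, Y) A f" for A f
    using that by (auto simp: linear_presentation_iff set_row dest: set_zip_rightD)
  have inj: "inj_on key (set X \<times> {0} \<union> set Y \<times> {1})"
    by (rule inj_onI) (auto simp: key_def; presburger)
  have "map key (zip Z e) = map key (zip Z' e')"
    using strict_sorted_equal[OF sorted] by (simp add: entries[OF lp(1)] entries[OF lp(2)])
  moreover have "inj_on key (set (zip Z e) \<union> set (zip Z' e'))"
    using inj unfolding entries[OF lp(1)] entries[OF lp(2)] Un_absorb .
  ultimately have "zip Z e = zip Z' e'" by (rule map_inj_on)
  hence "map fst (zip Z e) = map fst (zip Z' e')" "map snd (zip Z e) = map snd (zip Z' e')"
    by simp_all
  thus ?thesis using len[OF lp(1)] len[OF lp(2)] by simp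
qed

section \<open>Symbols\<close>

lemma distinct_symbol_row:
  assumes "symbol_row X"
  shows "distinct X"
proof -
  have "successively (<) X"
    using assms by (auto simp: symbol_row_def intro: successively_mono)
  thus ?thesis by (simp add: successively_conv_sorted_wrt strict_sorted_iff)
qed

lemma pair_bipartition_shift: "pair_bipartition (shift P) = pair_bipartition P"
proof -
  have "row_partition (0 # map (\<lambda>x. x + 2) X) = 0 # row_partition X" for X
    by (rule nth_equalityI) (auto simp: row_partition_def nth_Cons' less_Suc_eq_0_disj simp del: upt_Suc)
  thus ?thesis by (cases P) (simp add: pair_bipartition_def shift_def drop_zeros_def)
qed

lemma pair_bipartition_shift_equiv:
  assumes "(P, Q) \<in> shift_equiv d"
  shows "pair_bipartition P = pair_bipartition Q"
proof -
  have "equivclp (\<lambda>P Q. Q = shift P) P Q" using assms by (simp add: shift_equiv_def)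
  thus ?thesis
    by (induction rule: equivclp_induct) (auto simp: pair_bipartition_shift)
qed

lemma equiv_shift_equiv: "equiv (symbol_pairs d) (shift_equiv d)"
proof (rule equivI)
  show "shift_equiv d \<subseteq> symbol_pairs d \<times> symbol_pairs d"
    and "refl_on (symbol_pairs d) (shift_equiv d)"
    by (auto simp: shift_equiv_def refl_on_def)
  show "sym (shift_equiv d)"
    by (rule symI) (simp add: shift_equiv_def, metis equivclp_sym)
  show "trans (shift_equiv d)"
    by (rule transI) (simp add: shift_equiv_def, metis equivclp_trans)
qed

lemma symbol_bipartition_eq:
  assumes "L \<in> symbols d" and "P \<in> L"
  shows "symbol_bipartition L = pair_bipartition P"
proof -
  have "pair_bipartition Q = pair_bipartition P" if "Q \<in> L" for Q
    using quotient_eq_iff[OF equiv_shift_equiv] assms that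
    by (metis pair_bipartition_shift_equiv symbols_def)
  hence "pair_bipartition ` L = {pair_bipartition P}" using assms(2) by blast
  thus ?thesis by (simp add: symbol_bipartition_def)
qed

lemma ex1_symbol_containing:
  assumes "P \<in> symbol_pairs d"
  shows "\<exists>!L. L \<in> symbols d \<and> P \<in> L"
proof (rule ex1I)
  show "shift_equiv d `` {P} \<in> symbols d \<and> P \<in> shift_equiv d `` {P}"
    using assms equiv_class_self[OF equiv_shift_equiv assms] by (auto simp: symbols_def quotientI)
  fix L assume "L \<in> symbols d \<and> P \<in> L"
  then obtain Q where L: "L = shift_equiv d `` {Q}" and "(Q, P) \<in> shift_equiv d"
    unfolding symbols_def by (auto elim: quotientE)
  thus "L = shift_equiv d `` {P}" using equiv_class_eq[OF equiv_shift_equiv] by simp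
qed

section \<open>The symbol of a rather odd partition\<close>

theorem proposition5p4p2:
  fixes lam q eps delta z :: "nat list" and Z :: "int list"
  assumes "rather_odd lam"
    and "q = q_seq lam"
    and "eps = eps_seq lam"
    and "delta = delta_seq lam"
    and "z = [0..<length q]"
    and "Z = map (\<lambda>i. int (q ! i) + int (z ! i) - int (delta ! i)) [0..<length q]"
  shows "(\<exists>!L. L \<in> symbols (d_partition lam) \<and> (\<exists>P \<in> L. linear_presentation P Z eps)) \<and>
         (\<forall>L \<in> symbols (d_partition lam). \<forall>P \<in> L. linear_presentation P Z eps \<longrightarrow>
            rho_tilde lam = symbol_bipartition L \<and>
            canonical_linear_presentation P Z eps \<and>
            (\<forall>Z' eps'. canonical_linear_presentation P Z' eps' \<longrightarrow> Z' = Z \<and> eps' = eps))"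
proof -
  define X where "X = row 0 (entries lam)"
  define Y where "Y = row 1 (entries lam)"
  have Z: "Z = shifted_quotients lam"
    unfolding assms(6) shifted_quotients_def using assms(2,4,5) by (intro map_cong) auto
  hence ents: "zip Z eps = entries lam" by (simp add: entries_def assms(3))
  have len: "length Z = length eps"
    using length_seqs[OF assms(1)] by (simp add: Z shifted_quotients_def assms(3))
  have "0 \<le> Z ! i \<and> eps ! i \<in> {0, 1}" if "i < length Z" for i
  proof -
    have "(Z ! i, eps ! i) \<in> set (entries lam)"
      using that len by (metis ents in_set_zip fst_conv snd_conv)
    thus ?thesis using entries_range[OF assms(1)] by auto
  qed
  hence "\<forall>x \<in> set Z. 0 \<le> x" and "set eps \<subseteq> {0, 1}"
    using len by (metis in_set_conv_nth, metis in_set_conv_nth subsetI)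
  hence lp: "linear_presentation P Z eps \<longleftrightarrow> P = (X, Y)" for P
    using len by (cases P) (simp add: linear_presentation_iff ents X_def Y_def)
  have sym: "symbol_row X" "symbol_row Y"
    using symbol_row_entries[OF assms(1)] by (auto simp: X_def Y_def)
  hence pair: "(X, Y) \<in> symbol_pairs (d_partition lam)"
    using length_rows(2)[OF assms(1)] by (simp add: symbol_pairs_def X_def Y_def)
  have dist: "distinct X" "distinct Y" using sym by (auto intro: distinct_symbol_row)
  have canon: "canonical_linear_presentation (X, Y) Z eps"
    using canonical_iff_keys_increasing[of X Y Z eps] dist lp entries_keys_increasing[OF assms(1)]
    by (simp add: ents)
  have rho: "rho_tilde lam = pair_bipartition (X, Y)"
    using rho_raw_eq_row_partitions[OF assms(1)]
    by (simp add: rho_tilde_def pair_bipartition_def drop_zeros_def X_def Y_def)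
  have "\<exists>!L. L \<in> symbols (d_partition lam) \<and> (\<exists>P \<in> L. linear_presentation P Z eps)"
    using ex1_symbol_containing[OF pair] by (simp add: lp Bex_def conj_commute)
  moreover have "rho_tilde lam = symbol_bipartition L \<and> canonical_linear_presentation P Z eps \<and>
      (\<forall>Z' eps'. canonical_linear_presentation P Z' eps' \<longrightarrow> Z' = Z \<and> eps' = eps)"
    if "L \<in> symbols (d_partition lam)" "P \<in> L" "linear_presentation P Z eps" for L P
  proof -
    have P: "P = (X, Y)" using that(3) lp by simp
    have "rho_tilde lam = symbol_bipartition L"
      using rho symbol_bipartition_eq[OF that(1,2)] P by simp
    thus ?thesis using canon canonical_linear_presentation_unique[OF dist canon] P by blast
  qed
  ultimately show ?thesis by blast
qed

end
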